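(* Let $f(x)=\pi+\frac{1}{2}(4+\pi)x-2(x+2)\arctan\sqrt{x+1}$ for $x\geq -1$. (i) There do not exist real polynomials $P$ and $Q$ such that $Q(x)\neq 0$ for all $x\geq 0$ and $$\ln(1+x)\leq \frac{P(x)}{Q(x)}\leq \frac{f(x)}{\sqrt{x+1}}\quad\text{for all } x\geq 0.$$ (ii) There do not exist real polynomials $P$ and $Q$ such that $Q(x)\neq 0$ for all $x\in(-1,0]$ and $$\ln(1+x)\geq \frac{P(x)}{Q(x)}\geq \frac{f(x)}{\sqrt{x+1}}\quad\text{for all } x\in(-1,0].$$
   Context: A real polynomial is a polynomial in one variable with real coefficients. $\ln$ is the natural logarithm and $\arctan$ is the principal branch with values in $(-\pi/2,\pi/2)$. *)

theory Defs
  imports "HOL-Analysis.Analysis" "HOL-Computational_Algebra.Polynomial"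
begin

(* The function f of the statement is only meaningful for x >= -1;
   its values at x < -1 are never used. *)
definition bound_f :: "real \<Rightarrow> real" where
  "bound_f x = pi + 1 / 2 * (4 + pi) * x - 2 * (x + 2) * arctan (sqrt (x + 1))"

end

theory Submission
  imports Defs
begin

text \<open>
  Both parts are the same obstruction: a rational function has an integer order of growth at
  infinity, while a function between \<open>ln\<close> and a multiple of \<open>sqrt\<close> would need an order that is
  at most \<open>1 / 2\<close> and yet diverge. A rational function that is \<open>o(x)\<close> already converges to a
  finite limit (\<open>sublinear_rational_function_converges\<close>), whereas anything above \<open>ln x\<close>
  diverges; hence no rational function satisfies \<open>ln x \<le> R x \<le> C * sqrt x\<close> for all large \<open>x\<close>
  (\<open>no_rational_function_between_ln_and_sqrt\<close>).

  In the first part, the positivity of \<open>arctan (sqrt (x + 1))\<close> bounds \<open>bound_f x / sqrt (x + 1)\<close>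
  above by a multiple of \<open>sqrt x\<close> for \<open>x \<ge> 1\<close>, so the lemma applies to \<open>P / Q\<close> itself. In the
  second part the obstruction sits at the endpoint \<open>-1\<close>, near which \<open>bound_f\<close> is bounded below.
  Substituting \<open>x = 1 / y - 1\<close> moves this endpoint to infinity: \<open>ln (1 + x)\<close> becomes \<open>- ln y\<close> and
  \<open>1 / sqrt (x + 1)\<close> becomes \<open>sqrt y\<close>, so that \<open>- P / Q\<close>, which is again a rational function of
  \<open>y\<close>, lies between \<open>ln y\<close> and a multiple of \<open>sqrt y\<close>.
\<close>

lemma tendsto_poly_divide_at_infinity:
  fixes p q :: "'a::real_normed_field poly"
  assumes "degree p \<le> degree q"
  shows "\<exists>c. ((\<lambda>x. poly p x / poly q x) \<longlongrightarrow> c) at_infinity"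
proof (cases "degree p = degree q \<and> q \<noteq> 0")
  case True
  have "((\<lambda>x. (poly p x / x ^ degree p) / (poly q x / x ^ degree q))
          \<longlongrightarrow> lead_coeff p / lead_coeff q) at_infinity"
    using True by (intro tendsto_divide poly_divide_tendsto_aux) auto
  moreover have "\<forall>\<^sub>F x in at_infinity.
      (poly p x / x ^ degree p) / (poly q x / x ^ degree q) = poly p x / poly q x"
    by (rule eventually_at_infinityI[of 1]) (use True in auto)
  ultimately have "((\<lambda>x. poly p x / poly q x) \<longlongrightarrow> lead_coeff p / lead_coeff q) at_infinity"
    by (rule Lim_transform_eventually)
  then show ?thesis ..
next
  case False
  show ?thesis
  proof (cases "q = 0")
    case True
    then show ?thesis by auto
  next
    case nonzero: False
    show ?thesis
      using poly_divide_tendsto_0_at_infinity[of p q] False nonzero assms by auto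
  qed
qed

text \<open>
  For \<open>R = P / Q\<close>, the limit of \<open>R x / x\<close> excludes a numerator of larger degree than a nonzero
  denominator: in that case \<open>x / R x\<close> would have a finite limit too, although its product with \<open>R x / x\<close> is \<open>1\<close>.
\<close>

lemma sublinear_rational_function_converges:
  fixes P Q :: "real poly"
  assumes lim: "((\<lambda>x. poly P x / poly Q x / x) \<longlongrightarrow> 0) at_top"
  shows "\<exists>c. ((\<lambda>x. poly P x / poly Q x) \<longlongrightarrow> c) at_top"
proof (cases "Q = 0 \<or> degree P \<le> degree Q")
  case True
  then show ?thesis
  proof
    assume "Q = 0"
    then show ?thesis
      by (intro exI[of _ 0]) simp
  next
    assume "degree P \<le> degree Q"
    then obtain c where "((\<lambda>x. poly P x / poly Q x) \<longlongrightarrow> c) at_infinity"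
      using tendsto_poly_divide_at_infinity by blast
    then have "((\<lambda>x. poly P x / poly Q x) \<longlongrightarrow> c) at_top"
      by (rule tendsto_mono[OF at_top_le_at_infinity])
    then show ?thesis ..
  qed
next
  case False
  \<comment> \<open>\<open>pCons 0 Q\<close> is \<open>x\<close> times \<open>Q\<close>, so the quotient below is the reciprocal of \<open>R x / x\<close>.\<close>
  then have "degree (pCons 0 Q) \<le> degree P"
    by simp
  then obtain c where "((\<lambda>x. poly (pCons 0 Q) x / poly P x) \<longlongrightarrow> c) at_top"
    by (rule tendsto_poly_divide_at_infinity[THEN exE])
      (blast intro: tendsto_mono[OF at_top_le_at_infinity])
  then have "((\<lambda>x. (poly P x / poly Q x / x) * (poly (pCons 0 Q) x / poly P x)) \<longlongrightarrow> 0 * c) at_top"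
    by (intro tendsto_mult lim)
  moreover have "\<forall>\<^sub>F x in at_top. (poly P x / poly Q x / x) * (poly (pCons 0 Q) x / poly P x) = 1"
  proof -
    have "P \<noteq> 0" "Q \<noteq> 0"
      using False by auto
    then have "finite {x. x = 0 \<or> poly P x = 0 \<or> poly Q x = 0}"
      by (simp add: poly_roots_finite)
    then have "bdd_above {x. x = 0 \<or> poly P x = 0 \<or> poly Q x = 0}"
      by (rule bdd_above_finite)
    then obtain b where b: "\<forall>x\<in>{x. x = 0 \<or> poly P x = 0 \<or> poly Q x = 0}. x \<le> b"
      unfolding bdd_above_def ..
    have "x \<noteq> 0 \<and> poly P x \<noteq> 0 \<and> poly Q x \<noteq> 0" if "x > b" for x
      using b that by auto
    then have "\<forall>\<^sub>F x in at_top. x \<noteq> 0 \<and> poly P x \<noteq> 0 \<and> poly Q x \<noteq> 0"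
      by (auto simp: eventually_at_top_dense)
    then show ?thesis
      by eventually_elim simp
  qed
  ultimately have "((\<lambda>x::real. 1::real) \<longlongrightarrow> 0) at_top"
    by (simp add: Lim_transform_eventually)
  then show ?thesis
    by (simp add: tendsto_const_iff)
qed

lemma no_rational_function_between_ln_and_sqrt:
  fixes P Q :: "real poly"
  assumes lower: "\<forall>\<^sub>F x in at_top. ln x \<le> poly P x / poly Q x"
    and upper: "\<forall>\<^sub>F x in at_top. poly P x / poly Q x \<le> C * sqrt x"
  shows False
proof -
  have "((\<lambda>x. poly P x / poly Q x / x) \<longlongrightarrow> 0) at_top"
  proof (rule tendsto_sandwich)
    show "\<forall>\<^sub>F x in at_top. 0 \<le> poly P x / poly Q x / x"
      using lower eventually_ge_at_top[of 1]
    proof eventually_elim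
      case (elim x)
      then have "0 \<le> ln x" by simp
      with elim(1) have "0 \<le> poly P x / poly Q x" by (rule order_trans[rotated])
      then show ?case by (rule divide_nonneg_nonneg) (use elim(2) in simp)
    qed
    show "\<forall>\<^sub>F x in at_top. poly P x / poly Q x / x \<le> C * inverse (sqrt x)"
      using upper eventually_ge_at_top[of 1]
    proof eventually_elim
      case (elim x)
      then have "poly P x / poly Q x / x \<le> C * sqrt x / x"
        by (intro divide_right_mono) auto
      also have "\<dots> = C * inverse (sqrt x)"
        using elim real_sqrt_mult_self[of x] by (simp add: field_simps)
      finally show ?case .
    qed
    show "((\<lambda>x. C * inverse (sqrt x)) \<longlongrightarrow> 0) at_top"
      using tendsto_mult_right_zero[OF tendsto_inverse_0_at_top[OF sqrt_at_top]] .
  qed simp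
  then obtain c where "((\<lambda>x. poly P x / poly Q x) \<longlongrightarrow> c) at_top"
    using sublinear_rational_function_converges by blast
  moreover have "filterlim (\<lambda>x. poly P x / poly Q x) at_top at_top"
    by (rule filterlim_at_top_mono[OF ln_at_top lower])
  ultimately show False
    using not_tendsto_and_filterlim_at_infinity filterlim_at_top_imp_at_infinity
      trivial_limit_at_top_linorder by blast
qed

text \<open>
  Reversing the coefficients of a polynomial turns \<open>1 / y\<close> into \<open>y\<close> up to a power of \<open>y\<close>; so the
  substitution \<open>x = a + 1 / y\<close>, which exchanges \<open>a\<close> and infinity, preserves rationality.
\<close>

lemma rational_function_shifted_reciprocal:
  fixes P Q :: "'a::field poly"
  obtains P' Q' where
    "\<And>y. y \<noteq> 0 \<Longrightarrow> poly P' y / poly Q' y = poly P (a + 1 / y) / poly Q (a + 1 / y)"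
proof -
  define p where "p = pcompose P [:a, 1:]"
  define q where "q = pcompose Q [:a, 1:]"
  show ?thesis
  proof
    fix y :: 'a
    assume "y \<noteq> 0"
    then show "poly (reflect_poly p * monom 1 (degree q)) y / poly (reflect_poly q * monom 1 (degree p)) y
        = poly P (a + 1 / y) / poly Q (a + 1 / y)"
      by (simp add: poly_reflect_poly_nz poly_monom p_def q_def poly_pcompose inverse_eq_divide)
  qed
qed

text \<open>
  Dropping the negative \<open>arctan\<close> term leaves a linear function, and dividing that by
  \<open>sqrt (x + 1)\<close> gives order \<open>sqrt x\<close>.
\<close>

lemma bound_f_upper:
  assumes "x \<ge> 1"
  shows "bound_f x / sqrt (x + 1) \<le> (2 + 3 / 2 * pi) * sqrt x"
proof -
  have "bound_f x \<le> pi + 1 / 2 * (4 + pi) * x"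
    using assms by (simp add: bound_f_def)
  also have "\<dots> \<le> (2 + 3 / 2 * pi) * x"
    using mult_left_mono[OF assms, of pi] by (simp add: algebra_simps)
  also have "\<dots> = (2 + 3 / 2 * pi) * sqrt x * sqrt x"
    using assms by simp
  also have "\<dots> \<le> (2 + 3 / 2 * pi) * sqrt x * sqrt (x + 1)"
    using assms by (intro mult_left_mono) auto
  finally show ?thesis
    using assms by (simp add: divide_le_eq)
qed

text \<open>Replacing \<open>arctan\<close> by its supremum \<open>pi / 2\<close> leaves a linear function.\<close>

lemma bound_f_lower:
  assumes "- 1 < x" "x \<le> 0"
  shows "- (2 * pi) \<le> bound_f x"
proof -
  have "2 * (x + 2) * arctan (sqrt (x + 1)) \<le> 2 * (x + 2) * (pi / 2)"
    using assms arctan_ubound[of "sqrt (x + 1)"] by (intro mult_left_mono) auto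
  then have "- pi + (2 - pi / 2) * x \<le> bound_f x"
    by (simp add: bound_f_def field_simps)
  moreover have "(2 - pi / 2) * x \<ge> (2 - pi / 2) * (- 1)"
    using assms pi_less_4 by (intro mult_left_mono) auto
  ultimately show ?thesis
    using pi_gt3 by (simp add: field_simps)
qed

theorem theorem1p3:
  shows "(\<nexists>P Q :: real poly.
            (\<forall>x\<ge>0. poly Q x \<noteq> 0) \<and>
            (\<forall>x\<ge>0. ln (1 + x) \<le> poly P x / poly Q x \<and>
                    poly P x / poly Q x \<le> bound_f x / sqrt (x + 1)))
       \<and> (\<nexists>P Q :: real poly.
            (\<forall>x\<in>{-1<..0}. poly Q x \<noteq> 0) \<and>
            (\<forall>x\<in>{-1<..0}. ln (1 + x) \<ge> poly P x / poly Q x \<and>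
                    poly P x / poly Q x \<ge> bound_f x / sqrt (x + 1)))"
proof (intro conjI notI; elim exE conjE)
  fix P Q :: "real poly"
  assume bounds: "\<forall>x\<ge>0. ln (1 + x) \<le> poly P x / poly Q x \<and>
      poly P x / poly Q x \<le> bound_f x / sqrt (x + 1)"
  show False
  proof (rule no_rational_function_between_ln_and_sqrt)
    show "\<forall>\<^sub>F x in at_top. ln x \<le> poly P x / poly Q x"
      using eventually_ge_at_top[of 1]
    proof eventually_elim
      case (elim x)
      then have "ln x \<le> ln (1 + x)" by simp
      with bounds elim show ?case by (meson order_trans zero_le_one)
    qed
    show "\<forall>\<^sub>F x in at_top. poly P x / poly Q x \<le> (2 + 3 / 2 * pi) * sqrt x"
      using eventually_ge_at_top[of 1]
      by eventually_elim (meson bounds bound_f_upper order_trans zero_le_one)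
  qed
next
  fix P Q :: "real poly"
  assume bounds: "\<forall>x\<in>{-1<..0}. ln (1 + x) \<ge> poly P x / poly Q x \<and>
      poly P x / poly Q x \<ge> bound_f x / sqrt (x + 1)"
  obtain P' Q' where subst:
    "\<And>y. y \<noteq> 0 \<Longrightarrow> poly P' y / poly Q' y = poly (- P) (- 1 + 1 / y) / poly Q (- 1 + 1 / y)"
    using rational_function_shifted_reciprocal by blast
  have between: "ln y \<le> poly P' y / poly Q' y \<and> poly P' y / poly Q' y \<le> 2 * pi * sqrt y"
    if "y \<ge> 1" for y :: real
  proof -
    define x where "x = - 1 + 1 / y"
    have x: "- 1 < x" "x \<le> 0" "1 + x = 1 / y"
      using that by (auto simp: x_def)
    have value_at_y: "poly P' y / poly Q' y = - (poly P x / poly Q x)"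
      using subst[of y] that by (simp add: x_def)
    have "poly P x / poly Q x \<le> ln (1 + x)" "bound_f x / sqrt (x + 1) \<le> poly P x / poly Q x"
      using bounds x(1,2) by auto
    moreover have "ln (1 + x) = - ln y"
      using that x by (simp add: ln_div)
    moreover have "bound_f x / sqrt (x + 1) = bound_f x * sqrt y"
      using x by (simp add: add.commute real_sqrt_divide)
    moreover have "- (2 * pi) * sqrt y \<le> bound_f x * sqrt y"
      using bound_f_lower x that by (intro mult_right_mono) auto
    ultimately show ?thesis
      unfolding value_at_y by linarith
  qed
  show False
  proof (rule no_rational_function_between_ln_and_sqrt)
    show "\<forall>\<^sub>F y in at_top. ln y \<le> poly P' y / poly Q' y"
      using eventually_ge_at_top[of 1] by eventually_elim (use between in blast)
    show "\<forall>\<^sub>F y in at_top. poly P' y / poly Q' y \<le> 2 * pi * sqrt y"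
      using eventually_ge_at_top[of 1] by eventually_elim (use between in blast)
  qed
qed

end
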